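(* Consider the variational inequality on the unit disk $\mathcal{C}=\{z\in\mathbb{R}^2:\|z\|_2\le1\}$ with $F(x,y)=(-y,x)$. Let $\{x_t\}$ be the sequence generated by the unprojected primal QP update $x_{t+1}=x_t+\eta_tv_t$, with $v_t$ the exact minimizer of $\min_{w\in\mathcal V_0(x_t)}\frac12\|w+F(x_t)\|^2$ (no projection safeguard being active). For any initialization $x_0\ne0$ and any stepsize sequence $\{\eta_t\}_{t\ge0}\subset[0,1/2]$, exactly one of the following holds: (i) the sequence $\{x_t\}$ does not converge; (ii) the sequence $\{x_t\}$ converges to a point $x_\infty$ with $\|x_\infty\|\ge\|x_0\|>0$. In either case, $\liminf_{t\to\infty}\mathrm{Gap}(x_t)\ge\|x_0\|>0$. Consequently, no single-step primal QP method with $\alpha=0$ (i.e. of this form) achieves vanishing last-iterate gap for this instance, regardless of the stepsize schedule in $[0,1/2]$.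
   Context: The unit disk is encoded by the constraint $g(z)=\|z\|^2-1\le0$. For $\alpha=0$ the velocity polytope is $\mathcal V_0(z)=\{v\in\mathbb{R}^2:\nabla g(z)^\top v\le0\}$ if $g(z)\ge0$ (constraint active), and $\mathcal V_0(z)=\mathbb{R}^2$ if $g(z)<0$. The weak gap is $\mathrm{Gap}(z)=\max_{y\in\mathcal{C}}F(y)^\top(z-y)$. *)

theory Defs
  imports "HOL-Analysis.Analysis"
begin

definition unit_disk :: "(real ^ 2) set" where
  "unit_disk = {z. norm z \<le> 1}"

definition disk_constraint :: "real ^ 2 \<Rightarrow> real" where
  "disk_constraint z = (norm z)\<^sup>2 - 1"

definition rot_field :: "real ^ 2 \<Rightarrow> real ^ 2" where
  "rot_field z = vector [- (z $ 2), z $ 1]"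

definition gradient :: "('a::real_inner \<Rightarrow> real) \<Rightarrow> 'a \<Rightarrow> 'a" where
  "gradient f z = (THE d. GDERIV f z :> d)"

definition velocity_polytope0 :: "real ^ 2 \<Rightarrow> (real ^ 2) set" where
  "velocity_polytope0 z =
     (if disk_constraint z \<ge> 0 then {v. gradient disk_constraint z \<bullet> v \<le> 0} else UNIV)"

definition is_qp_velocity :: "real ^ 2 \<Rightarrow> real ^ 2 \<Rightarrow> bool" where
  "is_qp_velocity z v \<longleftrightarrow>
     is_arg_min (\<lambda>w. 1 / 2 * (norm (w + rot_field z))\<^sup>2) (\<lambda>w. w \<in> velocity_polytope0 z) v"

definition primal_qp_run :: "(nat \<Rightarrow> real) \<Rightarrow> (nat \<Rightarrow> real ^ 2) \<Rightarrow> bool" where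
  "primal_qp_run \<eta> x \<longleftrightarrow>
     (\<forall>t. \<exists>v. is_qp_velocity (x t) v \<and> x (Suc t) = x t + \<eta> t *\<^sub>R v)"

text \<open>The supremum is a maximum, see \<open>weak_gap_attained\<close> below.\<close>
definition weak_gap :: "real ^ 2 \<Rightarrow> real" where
  "weak_gap z = (SUP y\<in>unit_disk. rot_field y \<bullet> (z - y))"


text \<open>The definite description, the optimisation problem and the supremum above are all
  well defined.\<close>

lemma gradient_disk_constraint: "gradient disk_constraint z = 2 *\<^sub>R z"
proof -
  have 1: "GDERIV disk_constraint z :> 2 *\<^sub>R z"
    unfolding gderiv_def disk_constraint_def power2_norm_eq_inner
    by (rule derivative_eq_intros refl | simp add: inner_commute)+
  have "d = 2 *\<^sub>R z" if "GDERIV disk_constraint z :> d" for d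
  proof -
    have "(\<lambda>h. h \<bullet> d) = (\<lambda>h. h \<bullet> (2 *\<^sub>R z))"
      using that 1 unfolding gderiv_def by (rule has_derivative_unique)
    then have "\<forall>h. h \<bullet> d = h \<bullet> (2 *\<^sub>R z)" by (simp add: fun_eq_iff)
    then show ?thesis by (simp only: vector_eq_ldot)
  qed
  show ?thesis unfolding gradient_def by (rule the_equality) fact+
qed

lemma qp_velocity_unique: "\<exists>!v. is_qp_velocity z v"
proof (rule ex1I)
  have m: "- rot_field z \<in> velocity_polytope0 z"
    by (simp add: velocity_polytope0_def gradient_disk_constraint rot_field_def
        inner_vec_def sum_2)
  then show "is_qp_velocity z (- rot_field z)"
    by (simp add: is_qp_velocity_def is_arg_min_def not_less)
  fix v assume v: "is_qp_velocity z v"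
  have "\<not> 0 < (norm (v + rot_field z))\<^sup>2"
    using v m unfolding is_qp_velocity_def is_arg_min_def by force
  then show "v = - rot_field z" by (simp add: eq_neg_iff_add_eq_0)
qed

lemma primal_qp_run_exists: "\<exists>x. x 0 = x0 \<and> primal_qp_run \<eta> x"
proof (intro exI conjI)
  let ?x = "rec_nat x0 (\<lambda>t z. z + \<eta> t *\<^sub>R (THE v. is_qp_velocity z v))"
  show "?x 0 = x0" by simp
  show "primal_qp_run \<eta> ?x"
    unfolding primal_qp_run_def
  proof
    fix t
    show "\<exists>v. is_qp_velocity (?x t) v \<and> ?x (Suc t) = ?x t + \<eta> t *\<^sub>R v"
      using theI'[OF qp_velocity_unique[of "?x t"]] by auto
  qed
qed

lemma weak_gap_attained:
  obtains y where "y \<in> unit_disk" "weak_gap z = rot_field y \<bullet> (z - y)"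
    "\<And>u. u \<in> unit_disk \<Longrightarrow> rot_field u \<bullet> (z - u) \<le> weak_gap z"
proof -
  let ?f = "\<lambda>y. rot_field y \<bullet> (z - y)"
  have e: "unit_disk = cball 0 1" by (auto simp: unit_disk_def)
  have c: "compact unit_disk" unfolding e by (rule compact_cball)
  have n: "unit_disk \<noteq> {}"
    using norm_zero zero_le_one unfolding unit_disk_def by (metis empty_Collect_eq)
  have "continuous_on unit_disk ?f"
    by (auto simp: rot_field_def inner_vec_def sum_2 intro!: continuous_intros)
  then obtain y where y: "y \<in> unit_disk" "\<And>u. u \<in> unit_disk \<Longrightarrow> ?f u \<le> ?f y"
    using continuous_attains_sup[OF c n] by blast
  then have "weak_gap z = ?f y"
    unfolding weak_gap_def by (intro cSup_eq_maximum) auto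
  with y show thesis using that by auto
qed

end

theory Submission
  imports Defs
begin

text \<open>The rotation field is tangent to the circles around the origin, so the
  constraint never binds: the velocity is \<open>- rot_field (x t)\<close>, the squared norm of
  the iterate is multiplied by \<open>1 + (\<eta> t)\<^sup>2\<close>, and the norm never decreases.
  The gap dominates the norm, by testing it at the unit vector orthogonal to \<open>z\<close>.\<close>

lemma inner_rot_field_self [simp]: "rot_field z \<bullet> z = 0" "z \<bullet> rot_field z = 0"
  by (simp_all add: rot_field_def inner_vec_def sum_2)

text \<open>A quarter turn is skew-adjoint. In the gap this moves the field from the test point
  \<open>y\<close> to the fixed point \<open>z\<close>.\<close>

lemma inner_rot_field_left: "rot_field y \<bullet> z = - (y \<bullet> rot_field z)"
  by (simp add: rot_field_def inner_vec_def sum_2)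

lemma norm_rot_field [simp]: "norm (rot_field z) = norm z"
  by (simp add: norm_eq_sqrt_inner rot_field_def inner_vec_def sum_2)

text \<open>The vector \<open>- rot_field z\<close> makes the objective zero and is feasible even on
  an active constraint, being orthogonal to the gradient \<open>2 *\<^sub>R z\<close>.\<close>

lemma is_qp_velocity_iff: "is_qp_velocity z v \<longleftrightarrow> v = - rot_field z"
proof -
  have "- rot_field z \<in> velocity_polytope0 z"
    by (simp add: velocity_polytope0_def gradient_disk_constraint)
  then have "is_qp_velocity z (- rot_field z)"
    by (simp add: is_qp_velocity_def is_arg_min_def not_less)
  then show ?thesis
    using qp_velocity_unique by blast
qed

lemma primal_qp_run_Suc:
  assumes "primal_qp_run \<eta> x"
  shows "x (Suc t) = x t - \<eta> t *\<^sub>R rot_field (x t)"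
  using assms by (simp add: primal_qp_run_def is_qp_velocity_iff)

text \<open>Pythagoras: the step is orthogonal to the iterate and has length
  \<open>\<bar>\<eta> t\<bar> * norm (x t)\<close>.\<close>

lemma norm_primal_qp_run_Suc:
  assumes "primal_qp_run \<eta> x"
  shows "(norm (x (Suc t)))\<^sup>2 = (1 + (\<eta> t)\<^sup>2) * (norm (x t))\<^sup>2"
proof -
  have "(norm (x (Suc t)))\<^sup>2 = (norm (x t))\<^sup>2 + (norm (\<eta> t *\<^sub>R rot_field (x t)))\<^sup>2"
    unfolding primal_qp_run_Suc[OF assms] power2_norm_eq_inner
    by (simp add: inner_diff)
  then show ?thesis
    by (simp add: power_mult_distrib algebra_simps)
qed

lemma incseq_norm_primal_qp_run:
  assumes "primal_qp_run \<eta> x"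
  shows "incseq (\<lambda>t. norm (x t))"
proof (rule incseq_SucI)
  fix t
  have "(norm (x t))\<^sup>2 \<le> (norm (x (Suc t)))\<^sup>2"
    unfolding norm_primal_qp_run_Suc[OF assms] by (simp add: algebra_simps)
  then show "norm (x t) \<le> norm (x (Suc t))"
    by (rule power2_le_imp_le) simp
qed

lemma norm_le_weak_gap: "norm z \<le> weak_gap z"
proof -
  \<comment> \<open>The sign makes the gap term positive. For \<open>z = 0\<close> division by zero
    gives \<open>?y = 0\<close>, so no case split is needed.\<close>
  let ?y = "- (1 / norm z) *\<^sub>R rot_field z"
  have "?y \<in> unit_disk"
    by (simp add: unit_disk_def)
  moreover have "rot_field ?y \<bullet> (z - ?y) = norm z"
    \<comment> \<open>The term in \<open>?y\<close> alone vanishes by orthogonality;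
      skew-adjointness turns the other into \<open>(norm z)\<^sup>2 / norm z\<close>.\<close>
    unfolding inner_diff_right inner_rot_field_self inner_rot_field_left[of ?y z]
    by (simp add: power2_norm_eq_inner[symmetric] power2_eq_square)
  ultimately show ?thesis
    by (metis weak_gap_attained)
qed

theorem theorem7p4:
  fixes x :: "nat \<Rightarrow> real ^ 2" and \<eta> :: "nat \<Rightarrow> real"
  assumes "x 0 \<noteq> 0"
    and "\<forall>t. \<eta> t \<in> {0..1/2}"
    and "primal_qp_run \<eta> x"
  shows "(\<not> convergent x \<or>
      (\<exists>x_inf. x \<longlonglongrightarrow> x_inf \<and> norm x_inf \<ge> norm (x 0) \<and> norm (x 0) > 0))
    \<and> \<not> (\<not> convergent x \<and>
      (\<exists>x_inf. x \<longlonglongrightarrow> x_inf \<and> norm x_inf \<ge> norm (x 0) \<and> norm (x 0) > 0))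
    \<and> liminf (\<lambda>t. ereal (weak_gap (x t))) \<ge> ereal (norm (x 0))
    \<and> norm (x 0) > 0
    \<and> \<not> (\<lambda>t. weak_gap (x t)) \<longlonglongrightarrow> 0"
proof -
  have pos: "norm (x 0) > 0"
    using assms(1) by simp
  have mono: "norm (x 0) \<le> norm (x t)" for t
    using incseq_norm_primal_qp_run[OF assms(3)] by (simp add: incseq_def)
  have gap: "norm (x 0) \<le> weak_gap (x t)" for t
    using mono norm_le_weak_gap by (rule order_trans)
  have lim: "norm (x 0) \<le> norm l" if "x \<longlonglongrightarrow> l" for l
    using tendsto_norm[OF that] mono by (intro LIMSEQ_le_const) auto
  have "liminf (\<lambda>t. ereal (weak_gap (x t))) \<ge> ereal (norm (x 0))"
    using gap by (intro Liminf_bounded) simp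
  moreover have "\<not> (\<lambda>t. weak_gap (x t)) \<longlonglongrightarrow> 0"
    using LIMSEQ_le_const[of "\<lambda>t. weak_gap (x t)" 0 "norm (x 0)"] gap pos by auto
  ultimately show ?thesis
    \<comment> \<open>If a limit exists, \<open>lim\<close> gives its norm bound; the alternatives
      exclude each other because the second contains convergence.\<close>
    using pos lim unfolding convergent_def by blast
qed

end
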